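(* Let $F$ be a non-archimedean ordered field, $\mathcal{C}$ the set of all convex subgroups of $(F,+)$, and $Q=\{a+A: a\in F, A\in\mathcal{C}\}$ with operations $(a+A)+(b+B)=a+b+A+B$, $(a+A)(b+B)=ab+aB+bA+AB$, and order $\alpha\le\beta$ iff $(\forall x\in\alpha)(\exists y\in\beta)(x\le y)$. Then $(Q,+,\cdot,\le)$ is a solid (with $e(a+A)=A$, $s(a+A)=-a+A$, and for $\alpha=a+A\notin\mathcal{C}$, $u(\alpha)=1+A/a$, $d(\alpha)=\frac1a+\frac{A}{a^2}$).
   Context: A subset of $F$ is convex if it contains every element lying between two of its elements; sums/products of sets are elementwise, and the operations on $Q$ are independent of representatives. Write $x<y$ iff $x\le y$ and $x\ne y$. Assembly: a non-empty structure $(\mathcal{A},\ast)$ such that (1) $\ast$ is associative; (2) commutative; (3) for every $x$ there is $e$ with $x\ast e=x$ and such that $x\ast f=x$ implies $e\ast f=e$ (unique, denoted $e(x)$); (4) for every $x$ there is $s$ with $x\ast s=e(x)$ and $e(s)=e(x)$ (unique, denoted $s(x)$); (5) for all $x,y$, $e(x\ast y)=e(x)$ or $e(x\ast y)=e(y)$. Association: $(\mathcal{A},+,\cdot)$ with $(\mathcal{A},+)$ an assembly (operators $e,s$), $\mathcal{N}=\{x:x=e(x)\}$, $(\mathcal{A}\setminus\mathcal{N},\cdot)$ an assembly (operators $u,d$), and for all $x,y,z$: (1) $xy+xz=x(y+z)+e(x)y+e(x)z$; (2) $\exists w\,(e(x)y=e(w))$; (3) $e(xy)=e(x)y+e(y)x$;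 (4) if $x\ne e(x)$ then $e(u(x))=e(x)d(x)$; (5) $s(xy)=s(x)y$. Ordered association: an association with a total order $\le$ such that for all $x,y,z$: (1) $x\le y\Rightarrow x+z\le y+z$; (2) $y+e(x)=e(x)\Rightarrow (y\le e(x)\wedge s(y)\le e(x))$; (3) $(e(x)<x\wedge y\le z)\Rightarrow xy\le xz$; (4) $(e(y)\le y\le z)\Rightarrow e(x)y\le e(x)z$. Solid: an ordered association $(S,+,\cdot,\le)$ such that (1) there is $m$ with $m+x=x$ for all $x$; (2) there is $M$ with $e(x)+M=M$ for all $x$; (3) there is $u_0$ with $u_0x=x$ for all $x$; (4) for every $x$ there is $a$ with $x=a+e(x)$ and $e(a)=m$; (5) there is $x$ with $e(x)\ne m$ and $e(x)\ne M$; (6) for all $x,y$ with $x=e(x)$, $y=e(y)$ and $x<y$ there is $z$ with $z\ne e(z)$ and $x<z<y$. *)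

theory Defs
  imports Main "HOL-Library.Set_Algebras"
begin

definition is_neutral :: "'a set \<Rightarrow> ('a \<Rightarrow> 'a \<Rightarrow> 'a) \<Rightarrow> 'a \<Rightarrow> 'a \<Rightarrow> bool" where
  "is_neutral A f x e \<longleftrightarrow> e \<in> A \<and> f x e = x \<and> (\<forall>g\<in>A. f x g = x \<longrightarrow> f e g = e)"

definition neutral :: "'a set \<Rightarrow> ('a \<Rightarrow> 'a \<Rightarrow> 'a) \<Rightarrow> 'a \<Rightarrow> 'a" where
  "neutral A f x = (THE e. is_neutral A f x e)"

definition is_symmetric :: "'a set \<Rightarrow> ('a \<Rightarrow> 'a \<Rightarrow> 'a) \<Rightarrow> 'a \<Rightarrow> 'a \<Rightarrow> bool" where
  "is_symmetric A f x s \<longleftrightarrow> s \<in> A \<and> f x s = neutral A f x \<and> neutral A f s = neutral A f x"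

definition symmetric :: "'a set \<Rightarrow> ('a \<Rightarrow> 'a \<Rightarrow> 'a) \<Rightarrow> 'a \<Rightarrow> 'a" where
  "symmetric A f x = (THE s. is_symmetric A f x s)"

locale assembly =
  fixes A :: "'a set" and f :: "'a \<Rightarrow> 'a \<Rightarrow> 'a"  (infixl "\<star>" 70)
  assumes nonempty: "A \<noteq> {}"
    and closed: "\<lbrakk>x \<in> A; y \<in> A\<rbrakk> \<Longrightarrow> x \<star> y \<in> A"
    and assoc: "\<lbrakk>x \<in> A; y \<in> A; z \<in> A\<rbrakk> \<Longrightarrow> (x \<star> y) \<star> z = x \<star> (y \<star> z)"
    and commute: "\<lbrakk>x \<in> A; y \<in> A\<rbrakk> \<Longrightarrow> x \<star> y = y \<star> x"
    and ex_neutral: "x \<in> A \<Longrightarrow> \<exists>e. is_neutral A f x e"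
    and ex_symmetric: "x \<in> A \<Longrightarrow> \<exists>s. is_symmetric A f x s"
    and neutral_op: "\<lbrakk>x \<in> A; y \<in> A\<rbrakk> \<Longrightarrow>
      neutral A f (x \<star> y) = neutral A f x \<or> neutral A f (x \<star> y) = neutral A f y"
begin

lemma neutral_unique:
  assumes "x \<in> A" "is_neutral A f x e" "is_neutral A f x e'"
  shows "e = e'"
  using assms commute[of e e'] unfolding is_neutral_def by metis

lemma is_neutral_neutral: "x \<in> A \<Longrightarrow> is_neutral A f x (neutral A f x)"
  unfolding neutral_def using ex_neutral neutral_unique by (metis theI')

lemma symmetric_unique:
  assumes x: "x \<in> A" and s: "is_symmetric A f x s" and t: "is_symmetric A f x t"
  shows "s = t"
proof -
  let ?e = "neutral A f x"
  have A: "s \<in> A" "t \<in> A" "?e \<in> A"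
    using s t is_neutral_neutral[OF x] by (auto simp: is_symmetric_def is_neutral_def)
  have xs: "x \<star> s = ?e" "x \<star> t = ?e"
    using s t by (simp_all add: is_symmetric_def)
  have se: "s \<star> ?e = s" "t \<star> ?e = t"
    using s t is_neutral_neutral[of s] is_neutral_neutral[of t]
    by (auto simp: is_symmetric_def is_neutral_def)
  have "s = s \<star> (x \<star> t)" by (simp only: xs se)
  also have "\<dots> = (s \<star> x) \<star> t" by (rule assoc[OF A(1) x A(2), symmetric])
  also have "\<dots> = ?e \<star> t" by (simp only: commute[OF A(1) x] xs)
  also have "\<dots> = t" by (simp only: commute[OF A(3) A(2)] se)
  finally show ?thesis .
qed

lemma is_symmetric_symmetric: "x \<in> A \<Longrightarrow> is_symmetric A f x (symmetric A f x)"
  unfolding symmetric_def using ex_symmetric symmetric_unique by (metis theI')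

end

definition zeroless :: "'a set \<Rightarrow> ('a \<Rightarrow> 'a \<Rightarrow> 'a) \<Rightarrow> 'a set" where
  "zeroless S add = S - {x \<in> S. x = neutral S add x}"

locale two_operations =
  fixes S :: "'a set"
    and add :: "'a \<Rightarrow> 'a \<Rightarrow> 'a"  (infixl "\<oplus>" 65)
    and mul :: "'a \<Rightarrow> 'a \<Rightarrow> 'a"  (infixl "\<odot>" 70)
begin

abbreviation e :: "'a \<Rightarrow> 'a" where "e \<equiv> neutral S add"
abbreviation s :: "'a \<Rightarrow> 'a" where "s \<equiv> symmetric S add"
abbreviation u :: "'a \<Rightarrow> 'a" where "u \<equiv> neutral (zeroless S add) mul"
abbreviation d :: "'a \<Rightarrow> 'a" where "d \<equiv> symmetric (zeroless S add) mul"

end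

locale association = two_operations +
  assumes additive: "assembly S add"
    and mul_closed: "\<lbrakk>x \<in> S; y \<in> S\<rbrakk> \<Longrightarrow> x \<odot> y \<in> S"
    and multiplicative: "assembly (zeroless S add) mul"
    and distrib: "\<lbrakk>x \<in> S; y \<in> S; z \<in> S\<rbrakk> \<Longrightarrow>
      x \<odot> y \<oplus> x \<odot> z = x \<odot> (y \<oplus> z) \<oplus> e x \<odot> y \<oplus> e x \<odot> z"
    and neutral_mul: "\<lbrakk>x \<in> S; y \<in> S\<rbrakk> \<Longrightarrow> \<exists>w\<in>S. e x \<odot> y = e w"
    and neutral_of_mul: "\<lbrakk>x \<in> S; y \<in> S\<rbrakk> \<Longrightarrow> e (x \<odot> y) = e x \<odot> y \<oplus> e y \<odot> x"
    and neutral_unity: "\<lbrakk>x \<in> S; x \<noteq> e x\<rbrakk> \<Longrightarrow> e (u x) = e x \<odot> d x"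
    and symmetric_mul: "\<lbrakk>x \<in> S; y \<in> S\<rbrakk> \<Longrightarrow> s (x \<odot> y) = s x \<odot> y"

locale ordered_association = association +
  fixes le :: "'a \<Rightarrow> 'a \<Rightarrow> bool"  (infix "\<preceq>" 50)
  assumes total_order: "linear_order_on S {(x, y) \<in> S \<times> S. x \<preceq> y}"
    and add_mono: "\<lbrakk>x \<in> S; y \<in> S; z \<in> S; x \<preceq> y\<rbrakk> \<Longrightarrow> x \<oplus> z \<preceq> y \<oplus> z"
    and absorbed_le: "\<lbrakk>x \<in> S; y \<in> S; y \<oplus> e x = e x\<rbrakk> \<Longrightarrow> y \<preceq> e x \<and> s y \<preceq> e x"
    and mul_mono: "\<lbrakk>x \<in> S; y \<in> S; z \<in> S; e x \<preceq> x; e x \<noteq> x; y \<preceq> z\<rbrakk> \<Longrightarrow> x \<odot> y \<preceq> x \<odot> z"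
    and neutral_mul_mono: "\<lbrakk>x \<in> S; y \<in> S; z \<in> S; e y \<preceq> y; y \<preceq> z\<rbrakk> \<Longrightarrow> e x \<odot> y \<preceq> e x \<odot> z"
begin

abbreviation lt :: "'a \<Rightarrow> 'a \<Rightarrow> bool"  (infix "\<prec>" 50) where
  "x \<prec> y \<equiv> x \<preceq> y \<and> x \<noteq> y"

end

locale solid = ordered_association +
  assumes ex_bounds: "\<exists>m\<in>S. \<exists>M\<in>S.
        (\<forall>x\<in>S. m \<oplus> x = x)
      \<and> (\<forall>x\<in>S. e x \<oplus> M = M)
      \<and> (\<forall>x\<in>S. \<exists>a\<in>S. x = a \<oplus> e x \<and> e a = m)
      \<and> (\<exists>x\<in>S. e x \<noteq> m \<and> e x \<noteq> M)"
    and ex_one: "\<exists>u0\<in>S. \<forall>x\<in>S. u0 \<odot> x = x"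
    and separation: "\<lbrakk>x \<in> S; y \<in> S; x = e x; y = e y; x \<prec> y\<rbrakk> \<Longrightarrow>
      \<exists>z\<in>S. z \<noteq> e z \<and> x \<prec> z \<and> z \<prec> y"

definition convex_subgroup :: "'a::linordered_field set \<Rightarrow> bool" where
  "convex_subgroup A \<longleftrightarrow>
     0 \<in> A \<and> (\<forall>x\<in>A. \<forall>y\<in>A. x + y \<in> A) \<and> (\<forall>x\<in>A. - x \<in> A)
   \<and> (\<forall>x\<in>A. \<forall>y\<in>A. \<forall>z. x \<le> z \<and> z \<le> y \<longrightarrow> z \<in> A)"

definition Q :: "'a::linordered_field set set" where
  "Q = {a +o A | a A. convex_subgroup A}"

text \<open>The operations are given on representatives; \<open>Q_add_coset\<close> and \<open>Q_mult_coset\<close>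
  below show that the choice of representatives does not matter.\<close>

definition Q_add :: "'a::linordered_field set \<Rightarrow> 'a set \<Rightarrow> 'a set" where
  "Q_add \<alpha> \<beta> = (THE \<gamma>. \<exists>a A b B. convex_subgroup A \<and> convex_subgroup B \<and>
     \<alpha> = a +o A \<and> \<beta> = b +o B \<and> \<gamma> = (a + b) +o (A + B))"

definition Q_mult :: "'a::linordered_field set \<Rightarrow> 'a set \<Rightarrow> 'a set" where
  "Q_mult \<alpha> \<beta> = (THE \<gamma>. \<exists>a A b B. convex_subgroup A \<and> convex_subgroup B \<and>
     \<alpha> = a +o A \<and> \<beta> = b +o B \<and> \<gamma> = (a * b) +o (a *o B + b *o A + A * B))"

definition Q_le :: "'a::linordered_field set \<Rightarrow> 'a set \<Rightarrow> bool" where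
  "Q_le \<alpha> \<beta> \<longleftrightarrow> (\<forall>x\<in>\<alpha>. \<exists>y\<in>\<beta>. x \<le> y)"

lemma convex_subgroup_zero: "convex_subgroup A \<Longrightarrow> 0 \<in> A"
  and convex_subgroup_add: "\<lbrakk>convex_subgroup A; x \<in> A; y \<in> A\<rbrakk> \<Longrightarrow> x + y \<in> A"
  and convex_subgroup_uminus: "\<lbrakk>convex_subgroup A; x \<in> A\<rbrakk> \<Longrightarrow> - x \<in> A"
  unfolding convex_subgroup_def by blast+

lemma coset_eqD:
  assumes A: "convex_subgroup A" and B: "convex_subgroup B" and eq: "a +o A = b +o B"
  shows "A = B" and "b - a \<in> A"
proof -
  have mem: "x \<in> c +o C \<longleftrightarrow> x - c \<in> C" for x c :: 'a and C
    by (force simp: elt_set_plus_def)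
  have iff: "x - a \<in> A \<longleftrightarrow> x - b \<in> B" for x
    using eq mem by metis
  have ba: "b - a \<in> A" using iff[of b] convex_subgroup_zero[OF B] by simp
  then have ab: "- (b - a) \<in> A" using convex_subgroup_uminus[OF A] by blast
  have "x \<in> B \<longleftrightarrow> x \<in> A" for x
  proof -
    have "x \<in> B \<longleftrightarrow> x + (b - a) \<in> A" using iff[of "x + b"] by (simp add: algebra_simps)
    also have "\<dots> \<longleftrightarrow> x \<in> A"
    proof
      assume "x + (b - a) \<in> A"
      then have "(x + (b - a)) + - (b - a) \<in> A"
        using convex_subgroup_add[OF A _ ab] by blast
      then show "x \<in> A" by simp
    qed (rule convex_subgroup_add[OF A _ ba])
    finally show ?thesis .
  qed
  then show "A = B" by blast
  show "b - a \<in> A" by (rule ba)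
qed

lemma Q_add_coset:
  assumes "convex_subgroup A" "convex_subgroup B"
  shows "Q_add (a +o A) (b +o B) = (a + b) +o (A + B)"
  unfolding Q_add_def
proof (rule the_equality)
  fix \<gamma>
  assume "\<exists>a' A' b' B'. convex_subgroup A' \<and> convex_subgroup B' \<and>
     a +o A = a' +o A' \<and> b +o B = b' +o B' \<and> \<gamma> = (a' + b') +o (A' + B')"
  then show "\<gamma> = (a + b) +o (A + B)"
    by (elim exE conjE) (simp flip: set_plus_rearrange)
qed (intro exI conjI, (rule assms refl)+)

lemma convex_subgroup_abs:
  assumes A: "convex_subgroup A" and x: "x \<in> A" and "\<bar>y\<bar> \<le> \<bar>x\<bar>"
  shows "y \<in> A"
proof -
  have "\<bar>x\<bar> \<in> A" "- \<bar>x\<bar> \<in> A"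
    using x convex_subgroup_uminus[OF A x] by (simp_all add: abs_if)
  moreover have "- \<bar>x\<bar> \<le> y" "y \<le> \<bar>x\<bar>" using assms(3) by linarith+
  ultimately show ?thesis using A unfolding convex_subgroup_def by blast
qed

lemma times_closed_add:
  fixes A B :: "'a::linordered_field set"
  assumes A: "convex_subgroup A" and B: "convex_subgroup B"
    and "v \<in> A * B" "w \<in> A * B"
  shows "v + w \<in> A * B"
proof -
  obtain a b x y where v: "v = a * b" "a \<in> A" "b \<in> B" and w: "w = x * y" "x \<in> A" "y \<in> B"
    using assms by (auto elim!: set_times_elim)
  define p where "p = max \<bar>a\<bar> \<bar>x\<bar>"
  define q where "q = max \<bar>b\<bar> \<bar>y\<bar>"
  have "\<bar>a\<bar> \<in> A" "\<bar>x\<bar> \<in> A" "\<bar>b\<bar> \<in> B" "\<bar>y\<bar> \<in> B"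
    by (rule convex_subgroup_abs[OF A v(2)] convex_subgroup_abs[OF A w(2)]
        convex_subgroup_abs[OF B v(3)] convex_subgroup_abs[OF B w(3)], simp)+
  then have pA: "p \<in> A" and qB: "q \<in> B"
    by (simp_all add: p_def q_def max_def)
  have ppA: "p + p \<in> A" using convex_subgroup_add[OF A pA pA] .
  have p0: "0 \<le> p" and q0: "0 \<le> q" by (auto simp: p_def q_def)
  have "\<bar>a * b\<bar> \<le> p * q" "\<bar>x * y\<bar> \<le> p * q"
    unfolding abs_mult by (intro mult_mono; auto simp: p_def q_def)+
  then have le: "\<bar>v + w\<bar> \<le> (p + p) * q"
    using abs_triangle_ineq[of v w] by (simp add: v w distrib_right)
  show ?thesis
  proof (cases "q = 0")
    case True
    then have "v + w = p * q" using le by simp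
    then show ?thesis using pA qB by (simp add: set_times_intro)
  next
    case False
    then have "\<bar>(v + w) / q\<bar> \<le> \<bar>p + p\<bar>"
      using le p0 q0 by (simp add: divide_simps abs_divide)
    then have "(v + w) / q \<in> A" using convex_subgroup_abs[OF A ppA] by blast
    then have "(v + w) / q * q \<in> A * B" using qB by (rule set_times_intro)
    then show ?thesis using False by simp
  qed
qed

lemma Q_mult_coset_subset:
  fixes A B :: "'a::linordered_field set"
  assumes A: "convex_subgroup A" and B: "convex_subgroup B"
    and x: "a' - a \<in> A" and y: "b' - b \<in> B"
  shows "(a' * b') +o (a' *o B + b' *o A + A * B) \<subseteq> (a * b) +o (a *o B + b *o A + A * B)"
proof
  fix t assume "t \<in> (a' * b') +o (a' *o B + b' *o A + A * B)"
  then obtain p q r where t: "t = a' * b' + (a' * p + b' * q + r)"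
    and p: "p \<in> B" and q: "q \<in> A" and r: "r \<in> A * B"
    by (auto simp: elt_set_plus_def elt_set_times_def elim!: set_plus_elim)
  define x y where "x = a' - a" and "y = b' - b"
  have xy: "x \<in> A" "y \<in> B" using assms by (auto simp: x_def y_def)
  have "x * y + x * p \<in> A * B" "q * y + r \<in> A * B"
    using xy p q r by (auto intro!: times_closed_add[OF A B] set_times_intro)
  then have r': "(x * y + x * p) + (q * y + r) \<in> A * B" (is "?r \<in> _")
    by (rule times_closed_add[OF A B])
  have "y + p \<in> B" "x + q \<in> A" using convex_subgroup_add[OF B xy(2) p] convex_subgroup_add[OF A xy(1) q] .
  then have "a * (y + p) + b * (x + q) + ?r \<in> a *o B + b *o A + A * B"
    using r' by (intro set_plus_intro set_times_intro2)
  moreover have "t = a * b + (a * (y + p) + b * (x + q) + ?r)"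
    unfolding t x_def y_def by (simp add: algebra_simps)
  ultimately show "t \<in> (a * b) +o (a *o B + b *o A + A * B)"
    by (simp add: set_plus_intro2)
qed

lemma Q_mult_coset:
  assumes "convex_subgroup A" "convex_subgroup B"
  shows "Q_mult (a +o A) (b +o B) = (a * b) +o (a *o B + b *o A + A * B)"
  unfolding Q_mult_def
proof (rule the_equality)
  fix \<gamma>
  assume "\<exists>a' A' b' B'. convex_subgroup A' \<and> convex_subgroup B' \<and>
     a +o A = a' +o A' \<and> b +o B = b' +o B' \<and> \<gamma> = (a' * b') +o (a' *o B' + b' *o A' + A' * B')"
  then obtain a' A' b' B' where *: "convex_subgroup A'" "convex_subgroup B'"
      "a +o A = a' +o A'" "b +o B = b' +o B'"
    and \<gamma>: "\<gamma> = (a' * b') +o (a' *o B' + b' *o A' + A' * B')" by blast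
  have [simp]: "A' = A" "B' = B"
    using coset_eqD(1)[OF assms(1) *(1,3)] coset_eqD(1)[OF assms(2) *(2,4)] by simp_all
  have "a' - a \<in> A" "b' - b \<in> B" "a - a' \<in> A" "b - b' \<in> B"
    using coset_eqD(2)[OF assms(1) *(1,3)] coset_eqD(2)[OF assms(2) *(2,4)]
      coset_eqD(2)[OF *(1) assms(1) *(3)[symmetric]] coset_eqD(2)[OF *(2) assms(2) *(4)[symmetric]]
    by simp_all
  then show "\<gamma> = (a * b) +o (a *o B + b *o A + A * B)"
    unfolding \<gamma> by (simp, intro subset_antisym Q_mult_coset_subset assms)
qed (intro exI conjI, (rule assms refl)+)

end

theory Submission
  imports Defs
begin

text \<open>An assembly is the same thing as a commutative semigroup that is a union of groups whose
  identities form a chain. Convex subgroups form a chain under inclusion, and so do the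
  multiplicative groups \<open>1 + U\<close> with \<open>1 \<notin> U\<close>; their cosets are the elements of \<open>Q\<close> and the
  zeroless elements of \<open>Q\<close>. If \<open>1 \<notin> U\<close> then the elements of \<open>1 + U\<close> lie between \<open>1 / 2\<close> and \<open>2\<close>,
  so multiplying by them preserves every convex subgroup \<open>B\<close> and \<open>(1 + U) (b + B) = b + b U + B\<close>
  elementwise; hence the product of \<open>Q\<close> is the elementwise product of sets. Finally, two elements
  of \<open>Q\<close> are nested or disjoint, so \<open>\<alpha> \<le> \<beta>\<close> means that \<open>\<alpha> \<subseteq> \<beta>\<close> or that \<open>\<alpha>\<close> lies entirely below
  \<open>\<beta>\<close>; the remaining axioms then become elementwise statements. Non-archimedeanity supplies a
  convex subgroup other than \<open>{0}\<close> and \<open>F\<close>, the limited elements.\<close>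

section \<open>Assemblies as chains of groups\<close>

definition is_group_inverse :: "'a set \<Rightarrow> ('a \<Rightarrow> 'a \<Rightarrow> 'a) \<Rightarrow> 'a \<Rightarrow> 'a \<Rightarrow> 'a \<Rightarrow> bool" where
  "is_group_inverse A f e x s \<longleftrightarrow> e \<in> A \<and> s \<in> A \<and> f x e = x \<and> f x s = e \<and> f s e = s"

locale chain_of_groups =
  fixes A :: "'a set" and f :: "'a \<Rightarrow> 'a \<Rightarrow> 'a"  (infixl "\<star>" 70) and E :: "'a set"
  assumes nonempty: "A \<noteq> {}"
    and closed: "\<lbrakk>x \<in> A; y \<in> A\<rbrakk> \<Longrightarrow> x \<star> y \<in> A"
    and assoc: "\<lbrakk>x \<in> A; y \<in> A; z \<in> A\<rbrakk> \<Longrightarrow> (x \<star> y) \<star> z = x \<star> (y \<star> z)"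
    and commute: "\<lbrakk>x \<in> A; y \<in> A\<rbrakk> \<Longrightarrow> x \<star> y = y \<star> x"
    and ex_group_inverse: "x \<in> A \<Longrightarrow> \<exists>e\<in>E. \<exists>s. is_group_inverse A f e x s"
    and chain: "\<lbrakk>e \<in> E; e' \<in> E\<rbrakk> \<Longrightarrow> e \<star> e' = e \<or> e \<star> e' = e'"
begin

lemma is_neutral_if_group_inverse:
  assumes x_in: "x \<in> A" and inverse: "is_group_inverse A f e x s"
  shows "is_neutral A f x e"
  unfolding is_neutral_def
proof (intro conjI ballI impI)
  show "e \<in> A" "x \<star> e = x" using inverse by (simp_all add: is_group_inverse_def)
  fix g assume g_in: "g \<in> A" and absorb: "x \<star> g = x"
  have s_in: "s \<in> A" and x_s: "x \<star> s = e" using inverse by (simp_all add: is_group_inverse_def)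
  have "e \<star> g = (s \<star> x) \<star> g" using commute[OF x_in s_in] x_s by simp
  also have "\<dots> = s \<star> x" using assoc[OF s_in x_in g_in] absorb by simp
  also have "\<dots> = e" using commute[OF x_in s_in] x_s by simp
  finally show "e \<star> g = e" .
qed

lemma neutral_eq:
  assumes "x \<in> A" "is_group_inverse A f e x s"
  shows "neutral A f x = e"
  unfolding neutral_def
proof (rule the_equality)
  show neutral_e: "is_neutral A f x e" using assms by (rule is_neutral_if_group_inverse)
  fix e' assume "is_neutral A f x e'"
  with neutral_e show "e' = e" using commute unfolding is_neutral_def by metis
qed

lemma group_inverse_sym:
  assumes "x \<in> A" "is_group_inverse A f e x s" shows "is_group_inverse A f e s x"
  using assms commute unfolding is_group_inverse_def by metis

lemma is_symmetric_if_group_inverse: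
  assumes x_in: "x \<in> A" and inverse: "is_group_inverse A f e x s"
  shows "is_symmetric A f x s"
proof -
  have "s \<in> A" "x \<star> s = e" using inverse by (simp_all add: is_group_inverse_def)
  then show ?thesis
    using neutral_eq[OF x_in inverse] neutral_eq[OF _ group_inverse_sym[OF x_in inverse]]
    by (simp add: is_symmetric_def)
qed

lemma is_group_inverse_op:
  assumes x_inverse: "x \<in> A" "is_group_inverse A f e x s"
    and y_inverse: "y \<in> A" "is_group_inverse A f e' y t"
  shows "is_group_inverse A f (e \<star> e') (x \<star> y) (s \<star> t)"
proof -
  have s_laws: "e \<in> A" "s \<in> A" "x \<star> e = x" "x \<star> s = e" "s \<star> e = s"
    and t_laws: "e' \<in> A" "t \<in> A" "y \<star> e' = y" "y \<star> t = e'" "t \<star> e' = t"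
    using x_inverse y_inverse by (simp_all add: is_group_inverse_def)
  have interchange: "(p \<star> q) \<star> (r \<star> w) = (p \<star> r) \<star> (q \<star> w)"
    if "p \<in> A" "q \<in> A" "r \<in> A" "w \<in> A" for p q r w
    using that by (metis assoc closed commute)
  show ?thesis
    using x_inverse(1) y_inverse(1) s_laws t_laws
    by (simp add: is_group_inverse_def interchange closed)
qed

lemma assembly: "assembly A f"
proof
  show "\<exists>e. is_neutral A f x e" "\<exists>s. is_symmetric A f x s" if "x \<in> A" for x
    using ex_group_inverse that is_neutral_if_group_inverse is_symmetric_if_group_inverse
    by blast+
  fix x y assume members: "x \<in> A" "y \<in> A"
  then obtain e s e' t where "e \<in> E" "is_group_inverse A f e x s"
    and "e' \<in> E" "is_group_inverse A f e' y t"
    using ex_group_inverse by meson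
  then show "neutral A f (x \<star> y) = neutral A f x \<or> neutral A f (x \<star> y) = neutral A f y"
    using neutral_eq members is_group_inverse_op closed chain by metis
qed (rule nonempty closed assoc commute; assumption)+

lemma symmetric_eq:
  assumes "x \<in> A" "is_group_inverse A f e x s" shows "symmetric A f x = s"
  using assembly.symmetric_unique[OF assembly] assembly.is_symmetric_symmetric[OF assembly]
    is_symmetric_if_group_inverse assms by metis

end

section \<open>Convex subgroups\<close>

lemma convex_subgroupI:
  assumes "0 \<in> A" "\<And>x y. \<lbrakk>x \<in> A; y \<in> A\<rbrakk> \<Longrightarrow> x + y \<in> A"
    and downward_closed: "\<And>x y. \<lbrakk>x \<in> A; \<bar>y\<bar> \<le> \<bar>x\<bar>\<rbrakk> \<Longrightarrow> y \<in> A"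
  shows "convex_subgroup A"
  unfolding convex_subgroup_def
proof (intro conjI ballI allI impI)
  fix x y z assume "x \<in> A" "y \<in> A" "x \<le> z \<and> z \<le> y"
  then have "\<bar>z\<bar> \<le> \<bar>x\<bar> \<or> \<bar>z\<bar> \<le> \<bar>y\<bar>" by linarith
  with \<open>x \<in> A\<close> \<open>y \<in> A\<close> show "z \<in> A" using downward_closed by blast
qed (use assms in auto)

lemma convex_subgroup_zero_singleton: "convex_subgroup {0}"
  by (auto simp: convex_subgroup_def)

lemma convex_subgroup_UNIV: "convex_subgroup UNIV"
  by (auto simp: convex_subgroup_def)

definition limited :: "'a::linordered_field set" where
  "limited = {x. \<exists>n::nat. \<bar>x\<bar> \<le> of_nat n}"

lemma convex_subgroup_limited: "convex_subgroup limited"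
proof (rule convex_subgroupI)
  show "0 \<in> limited" by (auto simp: limited_def intro: exI[of _ 0])
  fix x y :: 'a assume x_limited: "x \<in> limited"
  show "y \<in> limited" if "\<bar>y\<bar> \<le> \<bar>x\<bar>"
    using x_limited that order_trans unfolding limited_def by blast
  assume "y \<in> limited"
  with x_limited obtain m n :: nat where "\<bar>x\<bar> \<le> of_nat m" "\<bar>y\<bar> \<le> of_nat n"
    unfolding limited_def by blast
  then have "\<bar>x + y\<bar> \<le> of_nat (m + n)" using abs_triangle_ineq[of x y] by simp
  then show "x + y \<in> limited" unfolding limited_def by blast
qed

lemma ex_proper_convex_subgroup:
  assumes nonarchimedean: "\<exists>x::'a::linordered_field. \<forall>n::nat. of_nat n < x"
  shows "\<exists>A::'a set. convex_subgroup A \<and> A \<noteq> {0} \<and> A \<noteq> UNIV"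
proof (intro exI conjI)
  show "convex_subgroup (limited :: 'a set)" by (rule convex_subgroup_limited)
  have "(1 :: 'a) \<in> limited" by (auto simp: limited_def intro: exI[of _ 1])
  then show "(limited :: 'a set) \<noteq> {0}" by (metis singletonD zero_neq_one)
  obtain w :: 'a where "\<And>n::nat. of_nat n < w" using nonarchimedean by blast
  then have "w \<notin> limited"
    using abs_ge_self[of w] by (auto simp: limited_def not_le intro: less_le_trans)
  then show "(limited :: 'a set) \<noteq> UNIV" by blast
qed

lemma convex_subgroup_diff: "\<lbrakk>convex_subgroup A; x \<in> A; y \<in> A\<rbrakk> \<Longrightarrow> x - y \<in> A"
  using convex_subgroup_add[of A x "- y"] convex_subgroup_uminus[of A y] by simp

lemma convex_subgroup_uminus_iff: "convex_subgroup A \<Longrightarrow> - x \<in> A \<longleftrightarrow> x \<in> A"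
  using convex_subgroup_uminus[of A x] convex_subgroup_uminus[of A "- x"] by auto

lemma convex_subgroup_abs_iff: "convex_subgroup A \<Longrightarrow> \<bar>x\<bar> \<in> A \<longleftrightarrow> x \<in> A"
  by (simp add: abs_if convex_subgroup_uminus_iff)

lemma convex_subgroup_abs_less:
  assumes "convex_subgroup A" "x \<in> A" "a \<notin> A" shows "\<bar>x\<bar> < \<bar>a\<bar>"
  using convex_subgroup_abs[OF assms(1,2), of a] assms(3) by linarith

lemma convex_subgroup_chain:
  assumes "convex_subgroup A" "convex_subgroup B" shows "A \<subseteq> B \<or> B \<subseteq> A"
proof (rule ccontr)
  assume "\<not> ?thesis"
  then obtain x y where "x \<in> A" "x \<notin> B" "y \<in> B" "y \<notin> A" by blast
  then have "\<bar>x\<bar> < \<bar>y\<bar>" "\<bar>y\<bar> < \<bar>x\<bar>" using convex_subgroup_abs_less assms by blast+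
  then show False by simp
qed

lemma convex_subgroup_absorb:
  assumes "convex_subgroup A" "convex_subgroup B" "A \<subseteq> B"
  shows "A + B = B"
proof
  show "A + B \<subseteq> B"
    using assms by (auto elim!: set_plus_elim intro: convex_subgroup_add)
  show "B \<subseteq> A + B" using convex_subgroup_zero[OF assms(1)] by (rule set_zero_plus2)
qed

lemma convex_subgroup_add_idem: "convex_subgroup A \<Longrightarrow> A + A = A"
  by (simp add: convex_subgroup_absorb)

lemma convex_subgroup_plus_cases:
  assumes "convex_subgroup A" "convex_subgroup B" shows "A + B = A \<or> A + B = B"
  using convex_subgroup_chain[OF assms] convex_subgroup_absorb[OF assms]
    convex_subgroup_absorb[OF assms(2,1)] by (auto simp: add.commute)

lemma convex_subgroup_plus:
  "\<lbrakk>convex_subgroup A; convex_subgroup B\<rbrakk> \<Longrightarrow> convex_subgroup (A + B)"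
  using convex_subgroup_plus_cases by metis

lemma convex_subgroup_times:
  assumes convex_A: "convex_subgroup A" and convex_B: "convex_subgroup B"
  shows "convex_subgroup (A * B)"
proof (rule convex_subgroupI)
  show "0 \<in> A * B"
    using set_times_intro[OF convex_subgroup_zero[OF convex_A] convex_subgroup_zero[OF convex_B]]
    by simp
  fix x y assume "x \<in> A * B"
  then obtain a b where x_eq: "x = a * b" and a_in: "a \<in> A" and b_in: "b \<in> B"
    by (auto elim: set_times_elim)
  assume y_le: "\<bar>y\<bar> \<le> \<bar>x\<bar>"
  show "y \<in> A * B"
  proof (cases "b = 0")
    case True
    then show ?thesis using y_le x_eq set_times_intro[OF a_in b_in] by simp
  next
    case False
    then have "\<bar>y / b\<bar> \<le> \<bar>a\<bar>" using y_le x_eq by (simp add: divide_simps abs_mult)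
    then have "y / b * b \<in> A * B"
      using convex_subgroup_abs[OF convex_A a_in] b_in by blast
    then show ?thesis using False by simp
  qed
qed (rule times_closed_add[OF convex_A convex_B])

lemma mem_scale_iff: "a \<noteq> 0 \<Longrightarrow> x \<in> a *o A \<longleftrightarrow> x / a \<in> A" for x a :: "'a::field"
  by (force simp: elt_set_times_def)

lemma zero_scale: "0 \<in> A \<Longrightarrow> 0 *o A = {0}" for A :: "'a::mult_zero set"
  by (auto simp: elt_set_times_def)

lemma convex_subgroup_scale:
  assumes convex_A: "convex_subgroup A" shows "convex_subgroup (a *o A)"
proof (cases "a = 0")
  case True
  then show ?thesis
    using convex_subgroup_zero[OF convex_A]
    by (simp add: zero_scale convex_subgroup_zero_singleton)
next
  case False
  show ?thesis
  proof (rule convex_subgroupI)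
    show "0 \<in> a *o A" using False convex_subgroup_zero[OF convex_A] by (simp add: mem_scale_iff)
    show "x + y \<in> a *o A" if "x \<in> a *o A" "y \<in> a *o A" for x y
      using that False convex_subgroup_add[OF convex_A]
      by (simp add: mem_scale_iff add_divide_distrib)
    show "y \<in> a *o A" if "x \<in> a *o A" "\<bar>y\<bar> \<le> \<bar>x\<bar>" for x y
      using that False convex_subgroup_abs[OF convex_A, of "x / a" "y / a"]
      by (simp add: mem_scale_iff divide_right_mono)
  qed
qed

lemmas convex_subgroup_intros =
  convex_subgroup_plus convex_subgroup_times convex_subgroup_scale

lemma convex_subgroup_uminus_one_scale:
  assumes "convex_subgroup A" shows "(- 1) *o A = A"
  by (auto simp: mem_scale_iff convex_subgroup_uminus_iff[OF assms])

section \<open>Cosets of convex subgroups\<close>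

lemma coset_eq_self:
  assumes "convex_subgroup A" "a \<in> A" shows "a +o A = A"
proof -
  have "x - a \<in> A \<longleftrightarrow> x \<in> A" for x
    using convex_subgroup_add[OF assms(1), of "x - a" a] convex_subgroup_diff[OF assms(1), of x a]
      assms(2) by auto
  then show ?thesis by (auto simp: set_minus_plus)
qed

lemma coset_eqI:
  assumes "convex_subgroup A" "c \<in> a +o A" shows "c +o A = a +o A"
proof -
  have "c +o A = a +o ((c - a) +o A)" by (simp add: set_plus_rearrange2)
  then show ?thesis using assms by (simp add: coset_eq_self set_minus_plus)
qed

lemma Q_coset: "convex_subgroup A \<Longrightarrow> a +o A \<in> Q"
  by (auto simp: Q_def)

lemma convex_subgroup_in_Q: "convex_subgroup A \<Longrightarrow> A \<in> Q"
  using Q_coset[of A 0] by simp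

lemma singleton_in_Q: "{a} \<in> Q"
  using Q_coset[OF convex_subgroup_zero_singleton, of a] by (simp add: elt_set_plus_def)

lemma Q_cases:
  assumes "x \<in> Q" obtains a A where "convex_subgroup A" "x = a +o A"
  using assms by (auto simp: Q_def)

lemma Q_cases_at:
  assumes "x \<in> Q" "c \<in> x" obtains A where "convex_subgroup A" "x = c +o A"
proof -
  obtain a A where "convex_subgroup A" "x = a +o A" using assms(1) by (rule Q_cases)
  then show thesis using that coset_eqI assms(2) by blast
qed

lemma mem_coset_self: "0 \<in> A \<Longrightarrow> a \<in> a +o A" for a :: "'a::monoid_add"
  using set_plus_intro2[of 0 A a] by simp

lemma Q_nonempty: "x \<in> Q \<Longrightarrow> x \<noteq> {}"
  using mem_coset_self convex_subgroup_zero by (auto elim!: Q_cases)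

lemma convex_subgroup_iff_zero_mem: "x \<in> Q \<Longrightarrow> convex_subgroup x \<longleftrightarrow> 0 \<in> x"
  using convex_subgroup_zero by (auto elim: Q_cases_at)

lemma Q_add_eq_plus: "\<lbrakk>x \<in> Q; y \<in> Q\<rbrakk> \<Longrightarrow> Q_add x y = x + y"
  by (elim Q_cases) (simp add: Q_add_coset set_plus_rearrange)

lemma plus_in_Q: "\<lbrakk>x \<in> Q; y \<in> Q\<rbrakk> \<Longrightarrow> x + y \<in> Q"
  by (elim Q_cases) (simp add: set_plus_rearrange Q_coset convex_subgroup_plus)

section \<open>The elementwise product\<close>

lemma one_plus_times_mem_iff:
  assumes convex_U: "convex_subgroup U" and u_in: "u \<in> U" and one_notin: "1 \<notin> U"
    and convex_B: "convex_subgroup B"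
  shows "(1 + u) * q \<in> B \<longleftrightarrow> q \<in> B"
proof -
  have "\<bar>u + u\<bar> < \<bar>1\<bar>"
    using convex_U u_in one_notin convex_subgroup_add convex_subgroup_abs_less by blast
  then have upper: "1 + u \<le> 2" and lower: "1 \<le> 2 * (1 + u)"
    by (simp_all add: abs_less_iff distrib_left)
  show ?thesis
  proof
    assume q_in: "q \<in> B"
    have "\<bar>(1 + u) * q\<bar> = (1 + u) * \<bar>q\<bar>" using lower by (simp add: abs_mult)
    also have "\<dots> \<le> 2 * \<bar>q\<bar>" using upper by (intro mult_right_mono) auto
    finally have "\<bar>(1 + u) * q\<bar> \<le> \<bar>q + q\<bar>" by (simp add: abs_mult flip: mult_2)
    moreover have "q + q \<in> B" using convex_B q_in q_in by (rule convex_subgroup_add)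
    ultimately show "(1 + u) * q \<in> B" using convex_B convex_subgroup_abs by blast
  next
    assume product_in: "(1 + u) * q \<in> B"
    have "1 * \<bar>q\<bar> \<le> 2 * (1 + u) * \<bar>q\<bar>" using lower by (intro mult_right_mono) auto
    also have "\<dots> = \<bar>(1 + u) * q + (1 + u) * q\<bar>"
      using lower by (simp add: abs_mult flip: mult_2)
    finally have "\<bar>q\<bar> \<le> \<bar>(1 + u) * q + (1 + u) * q\<bar>" by simp
    moreover have "(1 + u) * q + (1 + u) * q \<in> B"
      using convex_B product_in product_in by (rule convex_subgroup_add)
    ultimately show "q \<in> B" using convex_B convex_subgroup_abs by blast
  qed
qed

lemma one_coset_times_coset:
  assumes convex_U: "convex_subgroup U" and one_notin: "1 \<notin> U" and convex_B: "convex_subgroup B"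
  shows "(1 +o U) * (b +o B) = b +o (b *o U + B)"
proof
  show "(1 +o U) * (b +o B) \<subseteq> b +o (b *o U + B)"
  proof
    fix t assume "t \<in> (1 +o U) * (b +o B)"
    then obtain u q where "t = (1 + u) * (b + q)" and u_in: "u \<in> U" and "q \<in> B"
      by (auto elim!: set_times_elim simp: elt_set_plus_def)
    then have "t = b + (b * u + (1 + u) * q)" by (simp add: algebra_simps)
    moreover have "(1 + u) * q \<in> B"
      using \<open>q \<in> B\<close> by (simp add: one_plus_times_mem_iff[OF convex_U u_in one_notin convex_B])
    ultimately show "t \<in> b +o (b *o U + B)" using u_in by blast
  qed
next
  show "b +o (b *o U + B) \<subseteq> (1 +o U) * (b +o B)"
  proof
    fix t assume "t \<in> b +o (b *o U + B)"
    then obtain u q where t_eq: "t = b + (b * u + q)" and u_in: "u \<in> U" and "q \<in> B"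
      by (auto elim!: set_plus_elim simp: elt_set_plus_def elt_set_times_def)
    have "1 + u \<noteq> 0"
      using convex_U one_notin u_in convex_subgroup_uminus by (metis eq_neg_iff_add_eq_0)
    then have "q / (1 + u) \<in> B"
      using \<open>q \<in> B\<close> one_plus_times_mem_iff[OF convex_U u_in one_notin convex_B, of "q / (1 + u)"]
      by simp
    moreover have "t = (1 + u) * (b + q / (1 + u))"
      using \<open>1 + u \<noteq> 0\<close> by (simp add: t_eq field_simps)
    ultimately show "t \<in> (1 +o U) * (b +o B)" using u_in by blast
  qed
qed

lemma coset_eq_scale_one_coset: "a \<noteq> 0 \<Longrightarrow> a +o A = a *o (1 +o ((1 / a) *o A))" for a :: "'a::field"
  by (simp add: set_times_plus_distrib set_times_rearrange2)

lemma one_mem_scale_iff: "a \<noteq> 0 \<Longrightarrow> 1 \<in> (1 / a) *o A \<longleftrightarrow> a \<in> A" for a :: "'a::field"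
  by (simp add: mem_scale_iff)

lemma convex_subgroup_nonzero_if_notin: "\<lbrakk>convex_subgroup A; a \<notin> A\<rbrakk> \<Longrightarrow> a \<noteq> 0"
  using convex_subgroup_zero by blast

lemma convex_subgroup_times_subset_scale:
  assumes convex_A: "convex_subgroup A" and a_notin: "a \<notin> A" and convex_B: "convex_subgroup B"
  shows "A * B \<subseteq> a *o B"
proof
  have "a \<noteq> 0" using convex_A a_notin by (rule convex_subgroup_nonzero_if_notin)
  fix t assume "t \<in> A * B"
  then obtain p q where t_eq: "t = p * q" and p_in: "p \<in> A" and q_in: "q \<in> B"
    by (auto elim: set_times_elim)
  have "\<bar>t\<bar> \<le> \<bar>a\<bar> * \<bar>q\<bar>"
    using convex_subgroup_abs_less[OF convex_A p_in a_notin]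
    by (simp add: t_eq abs_mult mult_right_mono)
  then have "\<bar>t / a\<bar> \<le> \<bar>q\<bar>" using \<open>a \<noteq> 0\<close> by (simp add: divide_simps mult.commute)
  then show "t \<in> a *o B"
    using convex_subgroup_abs[OF convex_B q_in] \<open>a \<noteq> 0\<close> by (simp add: mem_scale_iff)
qed

lemma zeroless_coset_times_coset:
  assumes convex_A: "convex_subgroup A" and a_notin: "a \<notin> A" and convex_B: "convex_subgroup B"
  shows "(a +o A) * (b +o B) = (a * b) +o (a *o B + b *o A + A * B)"
proof -
  define U where "U = (1 / a) *o A"
  have a_nonzero: "a \<noteq> 0" using convex_A a_notin by (rule convex_subgroup_nonzero_if_notin)
  have convex_U: "convex_subgroup U" and one_notin: "1 \<notin> U"
    using convex_A a_notin a_nonzero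
    by (simp_all add: U_def convex_subgroup_scale one_mem_scale_iff)
  have A_eq: "A = a *o U" using a_nonzero by (simp add: U_def set_times_rearrange2)
  have "(a +o A) * (b +o B) = a *o ((1 +o U) * (b +o B))"
    using a_nonzero by (simp add: coset_eq_scale_one_coset[of a A] U_def set_times_rearrange3)
  also have "\<dots> = a *o (b +o (b *o U + B))"
    using convex_U one_notin convex_B by (simp add: one_coset_times_coset)
  also have "\<dots> = (a * b) +o (b *o A + a *o B)"
    by (simp add: A_eq set_times_plus_distribs set_times_rearrange2 mult.commute)
  also have "a *o B = A * B + a *o B"
    using convex_A convex_B a_notin
    by (simp add: convex_subgroup_absorb convex_subgroup_intros
        convex_subgroup_times_subset_scale)
  finally show ?thesis by (simp add: ac_simps)
qed

lemma coset_times_coset: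
  assumes convex: "convex_subgroup A" "convex_subgroup B"
  shows "(a +o A) * (b +o B) = (a * b) +o (a *o B + b *o A + A * B)"
proof -
  consider (left_zeroless) "a \<notin> A" | (right_zeroless) "b \<notin> B" | (subgroups) "a \<in> A" "b \<in> B"
    by blast
  then show ?thesis
  proof cases
    case left_zeroless
    then show ?thesis using convex by (simp add: zeroless_coset_times_coset)
  next
    case right_zeroless
    then show ?thesis
      using zeroless_coset_times_coset[of B b A a] convex by (simp add: ac_simps)
  next
    case subgroups
    then have "a *o B \<subseteq> A * B" "b *o A \<subseteq> A * B"
      by (simp_all add: set_times_mono3 set_times_mono4)
    then have "a *o B + b *o A + A * B = A * B"
      using convex by (simp add: add.assoc convex_subgroup_absorb convex_subgroup_intros)
    then show ?thesis
      using subgroups convex by (simp add: coset_eq_self convex_subgroup_times set_times_intro)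
  qed
qed

lemma Q_mult_eq_times: "\<lbrakk>x \<in> Q; y \<in> Q\<rbrakk> \<Longrightarrow> Q_mult x y = x * y"
  by (elim Q_cases) (simp add: Q_mult_coset coset_times_coset)

lemma times_in_Q: "\<lbrakk>x \<in> Q; y \<in> Q\<rbrakk> \<Longrightarrow> x * y \<in> Q"
  by (elim Q_cases) (simp add: coset_times_coset Q_coset convex_subgroup_intros)

section \<open>Neutral and symmetric elements\<close>

lemma is_group_inverse_Q_add:
  assumes "convex_subgroup A" shows "is_group_inverse Q Q_add A (a +o A) (- a +o A)"
  using assms Q_add_coset[OF assms assms, of _ 0]
  by (simp add: is_group_inverse_def Q_coset convex_subgroup_in_Q Q_add_coset
      convex_subgroup_add_idem)

lemma chain_of_groups_Q_add:
  "chain_of_groups (Q :: 'a::linordered_field set set) Q_add (Collect convex_subgroup)"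
proof
  show "(Q :: 'a set set) \<noteq> {}" using singleton_in_Q by blast
  show "\<exists>e\<in>Collect convex_subgroup. \<exists>s. is_group_inverse Q Q_add e x s"
    if "x \<in> Q" for x :: "'a set"
    using that is_group_inverse_Q_add by (blast elim: Q_cases)
qed (auto simp: Q_add_eq_plus plus_in_Q ac_simps convex_subgroup_in_Q
    dest: convex_subgroup_plus_cases)

lemmas assembly_Q_add = chain_of_groups.assembly[OF chain_of_groups_Q_add]

abbreviation (input) neutrix :: "'a::linordered_field set \<Rightarrow> 'a set" where
  "neutrix \<equiv> neutral Q Q_add"

abbreviation (input) zeroless_Q :: "'a::linordered_field set set" where
  "zeroless_Q \<equiv> zeroless Q Q_add"

abbreviation (input) unity :: "'a::linordered_field set \<Rightarrow> 'a set" where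
  "unity \<equiv> neutral zeroless_Q Q_mult"

abbreviation (input) reciprocal :: "'a::linordered_field set \<Rightarrow> 'a set" where
  "reciprocal \<equiv> symmetric zeroless_Q Q_mult"

lemma neutrix_coset: "convex_subgroup A \<Longrightarrow> neutrix (a +o A) = A"
  by (rule chain_of_groups.neutral_eq[OF chain_of_groups_Q_add Q_coset is_group_inverse_Q_add])

lemma neutrix_convex_subgroup: "convex_subgroup A \<Longrightarrow> neutrix A = A"
  using neutrix_coset[of A 0] by simp

lemma neutrix_singleton: "neutrix {a} = {0}"
  using neutrix_coset[OF convex_subgroup_zero_singleton, of a] by (simp add: elt_set_plus_def)

lemma symmetric_coset: "convex_subgroup A \<Longrightarrow> symmetric Q Q_add (a +o A) = - a +o A"
  by (rule chain_of_groups.symmetric_eq[OF chain_of_groups_Q_add Q_coset is_group_inverse_Q_add])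

lemma symmetric_in_Q: "x \<in> Q \<Longrightarrow> symmetric Q Q_add x \<in> Q"
  by (elim Q_cases) (simp add: symmetric_coset Q_coset)

lemma symmetric_eq_scale: "x \<in> Q \<Longrightarrow> symmetric Q Q_add x = (- 1) *o x"
  by (elim Q_cases) (simp add: symmetric_coset set_times_plus_distrib
      convex_subgroup_uminus_one_scale)

lemma convex_subgroup_neutrix: "x \<in> Q \<Longrightarrow> convex_subgroup (neutrix x)"
  by (elim Q_cases) (simp add: neutrix_coset)

lemma neutrix_in_Q: "x \<in> Q \<Longrightarrow> neutrix x \<in> Q"
  by (simp add: convex_subgroup_in_Q convex_subgroup_neutrix)

lemma coset_neutrix: "\<lbrakk>x \<in> Q; c \<in> x\<rbrakk> \<Longrightarrow> c +o neutrix x = x"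
  by (elim Q_cases_at) (auto simp: neutrix_coset)

lemma diff_mem_neutrix: "\<lbrakk>x \<in> Q; p \<in> x; q \<in> x\<rbrakk> \<Longrightarrow> p - q \<in> neutrix x"
  using coset_neutrix by (auto simp: set_minus_plus)

lemma plus_neutrix: "x \<in> Q \<Longrightarrow> x + neutrix x = x"
  by (elim Q_cases) (simp add: neutrix_coset set_plus_rearrange3 convex_subgroup_add_idem)

lemma eq_neutrix_iff_zero_mem: "x \<in> Q \<Longrightarrow> x = neutrix x \<longleftrightarrow> 0 \<in> x"
  using convex_subgroup_iff_zero_mem convex_subgroup_neutrix neutrix_convex_subgroup by metis

lemma zeroless_Q_eq: "zeroless_Q = {x \<in> Q. 0 \<notin> x}"
  using eq_neutrix_iff_zero_mem by (auto simp: zeroless_def)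

lemma coset_in_zeroless_Q_iff:
  "convex_subgroup A \<Longrightarrow> a +o A \<in> zeroless_Q \<longleftrightarrow> a \<notin> A"
  by (simp add: zeroless_Q_eq Q_coset convex_subgroup_uminus_iff flip: set_minus_plus)

lemma scale_one_coset_in_zeroless_Q:
  assumes "a \<noteq> 0" "convex_subgroup U" "1 \<notin> U" shows "a *o (1 +o U) \<in> zeroless_Q"
  using assms
  by (simp add: set_times_plus_distrib coset_in_zeroless_Q_iff convex_subgroup_scale
      mem_scale_iff)

lemma zeroless_Q_cases:
  assumes "x \<in> zeroless_Q"
  obtains a U where "a \<noteq> 0" "convex_subgroup U" "1 \<notin> U" "x = a *o (1 +o U)"
proof -
  obtain a A where convex_A: "convex_subgroup A" and x_eq: "x = a +o A"
    using assms by (auto simp: zeroless_Q_eq elim: Q_cases)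
  then have "a \<notin> A" using assms by (simp add: coset_in_zeroless_Q_iff)
  with convex_A have "a \<noteq> 0" by (rule convex_subgroup_nonzero_if_notin)
  then show thesis
    using that[of a "(1 / a) *o A"] convex_A x_eq \<open>a \<notin> A\<close>
    by (simp add: convex_subgroup_scale one_mem_scale_iff coset_eq_scale_one_coset[of a A])
qed

lemma scale_one_coset_times_scale_one_coset:
  assumes "convex_subgroup U" "1 \<notin> U" "convex_subgroup V"
  shows "(a *o (1 +o U)) * (b *o (1 +o V)) = (a * b) *o (1 +o (U + V))"
  using assms by (simp add: set_times_rearrange one_coset_times_coset)

lemma Q_mult_zeroless_eq_times:
  "\<lbrakk>x \<in> zeroless_Q; y \<in> zeroless_Q\<rbrakk> \<Longrightarrow> Q_mult x y = x * y"
  by (simp add: zeroless_Q_eq Q_mult_eq_times)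

lemma times_in_zeroless_Q:
  "\<lbrakk>x \<in> zeroless_Q; y \<in> zeroless_Q\<rbrakk> \<Longrightarrow> x * y \<in> zeroless_Q"
  by (auto simp: zeroless_Q_eq times_in_Q elim: set_times_elim)

lemma is_group_inverse_Q_mult:
  assumes "a \<noteq> 0" "convex_subgroup U" "1 \<notin> U"
  shows "is_group_inverse zeroless_Q Q_mult (1 +o U) (a *o (1 +o U)) ((1 / a) *o (1 +o U))"
proof -
  have scale_in: "b *o (1 +o U) \<in> zeroless_Q" if "b \<noteq> 0" for b
    using that assms by (simp add: scale_one_coset_in_zeroless_Q)
  have scale_mult: "Q_mult (b *o (1 +o U)) (c *o (1 +o U)) = (b * c) *o (1 +o U)"
    if "b \<noteq> 0" "c \<noteq> 0" for b c
    using that assms scale_in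
    by (simp add: Q_mult_zeroless_eq_times scale_one_coset_times_scale_one_coset
        convex_subgroup_add_idem)
  show ?thesis
    using assms(1) scale_in[of 1] scale_in[of "1 / a"]
      scale_mult[of a 1] scale_mult[of a "1 / a"] scale_mult[of "1 / a" 1]
    by (simp add: is_group_inverse_def)
qed

lemma chain_of_groups_Q_mult:
  "chain_of_groups (zeroless_Q :: 'a::linordered_field set set) Q_mult
     {1 +o U | U. convex_subgroup U \<and> 1 \<notin> U}" (is "chain_of_groups ?Z _ ?E")
proof
  show "?Z \<noteq> {}" using singleton_in_Q[of 1] by (auto simp: zeroless_Q_eq)
  show "\<exists>e\<in>?E. \<exists>s. is_group_inverse ?Z Q_mult e x s" if "x \<in> ?Z" for x
    using that by (elim zeroless_Q_cases) (use is_group_inverse_Q_mult in blast)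
  fix e e' :: "'a set" assume "e \<in> ?E" "e' \<in> ?E"
  then obtain U V where convex: "convex_subgroup U" "convex_subgroup V" and one_notin: "1 \<notin> U"
    and e_eq: "e = 1 +o U" and e'_eq: "e' = 1 +o V" by blast
  then have "Q_mult e e' = 1 +o (U + V)"
    using one_coset_times_coset[of U V 1] by (simp add: Q_mult_eq_times Q_coset)
  then show "Q_mult e e' = e \<or> Q_mult e e' = e'"
    using convex_subgroup_plus_cases[OF convex] e_eq e'_eq by metis
qed (simp_all add: Q_mult_zeroless_eq_times times_in_zeroless_Q ac_simps)

lemmas assembly_Q_mult = chain_of_groups.assembly[OF chain_of_groups_Q_mult]

lemma unity_scale_one_coset:
  assumes "a \<noteq> 0" "convex_subgroup U" "1 \<notin> U"
  shows "unity (a *o (1 +o U)) = 1 +o U"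
  using chain_of_groups_Q_mult scale_one_coset_in_zeroless_Q[OF assms]
    is_group_inverse_Q_mult[OF assms]
  by (rule chain_of_groups.neutral_eq)

lemma reciprocal_scale_one_coset:
  assumes "a \<noteq> 0" "convex_subgroup U" "1 \<notin> U"
  shows "reciprocal (a *o (1 +o U)) = (1 / a) *o (1 +o U)"
  using chain_of_groups_Q_mult scale_one_coset_in_zeroless_Q[OF assms]
    is_group_inverse_Q_mult[OF assms]
  by (rule chain_of_groups.symmetric_eq)

lemma unity_coset:
  assumes "convex_subgroup A" "a \<notin> A"
  shows "unity (a +o A) = 1 +o ((\<lambda>x. x / a) ` A)"
proof -
  have "a \<noteq> 0" using assms by (rule convex_subgroup_nonzero_if_notin)
  moreover have "(\<lambda>x. x / a) ` A = (1 / a) *o A" by (auto simp: elt_set_times_def)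
  ultimately show ?thesis
    using assms by (simp add: coset_eq_scale_one_coset[of a A] unity_scale_one_coset
        convex_subgroup_scale one_mem_scale_iff)
qed

lemma reciprocal_coset:
  assumes "convex_subgroup A" "a \<notin> A"
  shows "reciprocal (a +o A) = (1 / a) +o ((\<lambda>x. x / a\<^sup>2) ` A)"
proof -
  have "a \<noteq> 0" using assms by (rule convex_subgroup_nonzero_if_notin)
  have "reciprocal (a +o A) = (1 / a) *o (1 +o ((1 / a) *o A))"
    using assms \<open>a \<noteq> 0\<close> by (simp add: coset_eq_scale_one_coset[of a A] reciprocal_scale_one_coset
        convex_subgroup_scale one_mem_scale_iff)
  also have "\<dots> = (1 / a) +o ((1 / a\<^sup>2) *o A)"
    by (simp add: set_times_plus_distrib set_times_rearrange2 power2_eq_square)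
  also have "(1 / a\<^sup>2) *o A = (\<lambda>x. x / a\<^sup>2) ` A" by (auto simp: elt_set_times_def)
  finally show ?thesis .
qed

section \<open>The association axioms\<close>

lemma convex_subgroup_times_coset:
  assumes "convex_subgroup A" "convex_subgroup B"
  shows "A * (b +o B) = b *o A + A * B"
  using coset_times_coset[OF assms, of 0 b] convex_subgroup_zero[OF assms(2)]
  by (simp add: zero_scale)

lemma convex_subgroup_times_Q: "\<lbrakk>convex_subgroup A; y \<in> Q\<rbrakk> \<Longrightarrow> convex_subgroup (A * y)"
  by (elim Q_cases) (simp add: convex_subgroup_times_coset convex_subgroup_intros)

lemma neutrix_times:
  assumes "x \<in> Q" "y \<in> Q" shows "neutrix (x * y) = neutrix x * y + neutrix y * x"
proof -
  obtain a A b B where convex: "convex_subgroup A" "convex_subgroup B"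
    and x_eq: "x = a +o A" and y_eq: "y = b +o B"
    using assms by (elim Q_cases)
  have "neutrix (x * y) = a *o B + b *o A + A * B"
    using convex by (simp add: x_eq y_eq coset_times_coset neutrix_coset convex_subgroup_intros)
  also have "\<dots> = a *o B + b *o A + (A * B + A * B)"
    using convex by (simp add: convex_subgroup_add_idem convex_subgroup_times)
  also have "\<dots> = (b *o A + A * B) + (a *o B + B * A)" by (simp add: ac_simps)
  finally show ?thesis
    using convex by (simp add: x_eq y_eq neutrix_coset convex_subgroup_times_coset)
qed

lemma times_plus_neutrix_times:
  assumes "x \<in> Q" "y \<in> Q" shows "x * y + neutrix x * y = x * y"
proof -
  have "neutrix x * y + neutrix x * y = neutrix x * y"
    using assms
    by (simp add: convex_subgroup_add_idem convex_subgroup_times_Q convex_subgroup_neutrix)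
  moreover have "neutrix (x * y) + neutrix x * y
      = (neutrix x * y + neutrix x * y) + neutrix y * x"
    using assms by (simp add: neutrix_times ac_simps)
  ultimately have "neutrix (x * y) + neutrix x * y = neutrix (x * y)"
    using assms by (simp add: neutrix_times)
  then show ?thesis using plus_neutrix[OF times_in_Q[OF assms]] by (metis add.assoc)
qed

lemma set_times_plus_subdistrib: "A * (B + C) \<subseteq> A * B + A * C" for A B C :: "'a::semiring set"
proof
  fix t assume "t \<in> A * (B + C)"
  then obtain a b c where "t = a * b + a * c" and "a \<in> A" "b \<in> B" "c \<in> C"
    by (auto elim!: set_times_elim set_plus_elim simp: distrib_left)
  then show "t \<in> A * B + A * C" by blast
qed

lemma times_distrib_neutrix:
  assumes in_Q: "x \<in> Q" "y \<in> Q" "z \<in> Q"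
  shows "x * y + x * z = x * (y + z) + neutrix x * y + neutrix x * z"
proof
  show "x * y + x * z \<subseteq> x * (y + z) + neutrix x * y + neutrix x * z"
  proof
    fix t assume "t \<in> x * y + x * z"
    then obtain p q p' r where t_eq: "t = p * q + p' * r"
      and members: "p \<in> x" "q \<in> y" "p' \<in> x" "r \<in> z"
      by (auto elim!: set_plus_elim set_times_elim)
    have "0 \<in> neutrix x" "p' - p \<in> neutrix x"
      using in_Q(1) members
      by (simp_all add: convex_subgroup_zero convex_subgroup_neutrix diff_mem_neutrix)
    then have "p * (q + r) + 0 * q + (p' - p) * r \<in> x * (y + z) + neutrix x * y + neutrix x * z"
      using members by (intro set_plus_intro set_times_intro)
    then show "t \<in> x * (y + z) + neutrix x * y + neutrix x * z" by (simp add: t_eq algebra_simps)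
  qed
  have "x * (y + z) + neutrix x * y + neutrix x * z
      \<subseteq> x * y + x * z + neutrix x * y + neutrix x * z"
    by (intro set_plus_mono2 set_times_plus_subdistrib subset_refl)
  also have "\<dots> = (x * y + neutrix x * y) + (x * z + neutrix x * z)" by (simp add: ac_simps)
  also have "\<dots> = x * y + x * z" using in_Q by (simp add: times_plus_neutrix_times)
  finally show "x * (y + z) + neutrix x * y + neutrix x * z \<subseteq> x * y + x * z" .
qed

lemma neutrix_unity:
  assumes "x \<in> zeroless_Q"
  shows "neutrix (unity x) = neutrix x * reciprocal x"
proof -
  obtain a U where normal_form: "a \<noteq> 0" "convex_subgroup U" "1 \<notin> U"
    and x_eq: "x = a *o (1 +o U)"
    using assms by (rule zeroless_Q_cases)
  have "neutrix x = a *o U"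
    using normal_form
    by (simp add: x_eq set_times_plus_distrib neutrix_coset convex_subgroup_scale)
  then have "neutrix x * reciprocal x = (1 +o U) * (0 +o U)"
    using normal_form
    by (simp add: x_eq reciprocal_scale_one_coset set_times_rearrange
        mult.commute[of U])
  also have "\<dots> = U"
    using one_coset_times_coset[of U U 0] normal_form
    by (simp add: zero_scale convex_subgroup_zero)
  finally show ?thesis
    using normal_form by (simp add: x_eq unity_scale_one_coset neutrix_coset)
qed

lemma association_Q: "association (Q :: 'a::linordered_field set set) Q_add Q_mult"
proof (rule association.intro[OF assembly_Q_add _ assembly_Q_mult])
  fix x y z :: "'a set" assume in_Q: "x \<in> Q" "y \<in> Q" "z \<in> Q"
  then show "Q_add (Q_mult x y) (Q_mult x z)
      = Q_add (Q_add (Q_mult x (Q_add y z)) (Q_mult (neutrix x) y)) (Q_mult (neutrix x) z)"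
    using times_distrib_neutrix[OF in_Q]
    by (simp add: Q_add_eq_plus Q_mult_eq_times plus_in_Q times_in_Q neutrix_in_Q)
next
  fix x y :: "'a set" assume in_Q: "x \<in> Q" "y \<in> Q"
  have "convex_subgroup (neutrix x * y)"
    using in_Q by (simp add: convex_subgroup_times_Q convex_subgroup_neutrix)
  then show "\<exists>w\<in>Q. Q_mult (neutrix x) y = neutrix w"
    using in_Q
    by (metis Q_mult_eq_times neutrix_in_Q convex_subgroup_in_Q neutrix_convex_subgroup)
  show "neutrix (Q_mult x y) = Q_add (Q_mult (neutrix x) y) (Q_mult (neutrix y) x)"
    using in_Q by (simp add: neutrix_times Q_add_eq_plus Q_mult_eq_times times_in_Q neutrix_in_Q)
  have "symmetric Q Q_add (x * y) = symmetric Q Q_add x * y"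
    using in_Q by (simp add: symmetric_eq_scale times_in_Q set_times_rearrange3)
  then show "symmetric Q Q_add (Q_mult x y) = Q_mult (symmetric Q Q_add x) y"
    using in_Q by (simp add: Q_mult_eq_times symmetric_in_Q)
next
  fix x :: "'a set" assume x_in: "x \<in> Q" and "x \<noteq> neutrix x"
  then have x_zeroless: "x \<in> zeroless_Q" by (simp add: zeroless_def)
  have "reciprocal x \<in> Q"
    using assembly.is_symmetric_symmetric[OF assembly_Q_mult x_zeroless]
    by (simp add: is_symmetric_def zeroless_Q_eq)
  then show "neutrix (unity x) = Q_mult (neutrix x) (reciprocal x)"
    using x_in neutrix_unity[OF x_zeroless] by (simp add: Q_mult_eq_times neutrix_in_Q)
qed (simp add: Q_mult_eq_times times_in_Q)

section \<open>The order\<close>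

lemma Q_nested_or_disjoint:
  assumes "x \<in> Q" "y \<in> Q" shows "x \<subseteq> y \<or> y \<subseteq> x \<or> x \<inter> y = {}"
proof (cases "x \<inter> y = {}")
  case False
  then obtain c where "c \<in> x" "c \<in> y" by blast
  then have "c +o neutrix x = x" "c +o neutrix y = y" using assms by (simp_all add: coset_neutrix)
  moreover have "neutrix x \<subseteq> neutrix y \<or> neutrix y \<subseteq> neutrix x"
    using assms by (simp add: convex_subgroup_chain convex_subgroup_neutrix)
  ultimately show ?thesis using set_plus_mono by blast
qed simp

lemma Q_order_convex:
  assumes x_in: "x \<in> Q" and p_in: "p \<in> x" and r_in: "r \<in> x" and "p \<le> q" "q \<le> r"
  shows "q \<in> x"
proof -
  have "\<bar>q - p\<bar> \<le> \<bar>r - p\<bar>" using assms(4,5) by simp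
  then have "q - p \<in> neutrix x"
    using convex_subgroup_abs[OF convex_subgroup_neutrix[OF x_in]
        diff_mem_neutrix[OF x_in r_in p_in]]
    by blast
  then show ?thesis using coset_neutrix[OF x_in p_in] by (simp add: set_minus_plus)
qed

lemma Q_le_if_subset: "x \<subseteq> y \<Longrightarrow> Q_le x y"
  by (auto simp: Q_le_def)

lemma Q_le_supset_imp_eq:
  assumes x_in: "x \<in> Q" and y_in: "y \<in> Q" and subset: "y \<subseteq> x" and x_le_y: "Q_le x y"
  shows "x = y"
proof -
  obtain c where c_in: "c \<in> y" using Q_nonempty[OF y_in] by blast
  then have x_eq: "c +o neutrix x = x" and y_eq: "c +o neutrix y = y"
    using x_in y_in subset by (auto simp: coset_neutrix)
  have "neutrix x \<subseteq> neutrix y"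
  proof
    fix p assume "p \<in> neutrix x"
    then have "c + \<bar>p\<bar> \<in> x"
      using x_eq convex_subgroup_abs_iff[OF convex_subgroup_neutrix[OF x_in]] by blast
    then obtain q where q_in: "q \<in> y" and "c + \<bar>p\<bar> \<le> q" using x_le_y by (auto simp: Q_le_def)
    then have "\<bar>p\<bar> \<le> \<bar>q - c\<bar>" by linarith
    then show "p \<in> neutrix y"
      using convex_subgroup_abs[OF convex_subgroup_neutrix[OF y_in]
          diff_mem_neutrix[OF y_in q_in c_in]]
      by blast
  qed
  then have "c +o neutrix x \<subseteq> c +o neutrix y" by (rule set_plus_mono)
  then show ?thesis using subset x_eq y_eq by simp
qed

lemma Q_le_iff:
  assumes x_in: "x \<in> Q" and y_in: "y \<in> Q"
  shows "Q_le x y \<longleftrightarrow> x \<subseteq> y \<or> (\<forall>p\<in>x. \<forall>q\<in>y. p < q)"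
proof
  assume x_le_y: "Q_le x y"
  consider (subset) "x \<subseteq> y" | (supset) "y \<subseteq> x" | (disjoint) "x \<inter> y = {}"
    using Q_nested_or_disjoint x_in y_in by blast
  then show "x \<subseteq> y \<or> (\<forall>p\<in>x. \<forall>q\<in>y. p < q)"
  proof cases
    case supset
    then show ?thesis using Q_le_supset_imp_eq[OF x_in y_in _ x_le_y] by blast
  next
    case disjoint
    have "p < q" if "p \<in> x" "q \<in> y" for p q
    proof (rule ccontr)
      assume "\<not> p < q"
      moreover obtain r where "r \<in> y" "p \<le> r" using x_le_y \<open>p \<in> x\<close> by (auto simp: Q_le_def)
      ultimately have "p \<in> y" using Q_order_convex[OF y_in \<open>q \<in> y\<close>] by simp
      then show False using disjoint \<open>p \<in> x\<close> by blast
    qed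
    then show ?thesis by blast
  qed simp
next
  assume "x \<subseteq> y \<or> (\<forall>p\<in>x. \<forall>q\<in>y. p < q)"
  then show "Q_le x y" using Q_nonempty[OF y_in] by (auto simp: Q_le_def intro: less_imp_le)
qed

lemma Q_le_antisym:
  assumes "x \<in> Q" "y \<in> Q" "Q_le x y" "Q_le y x" shows "x = y"
proof -
  obtain p q where "p \<in> x" "q \<in> y" using assms(1,2) Q_nonempty by blast
  then have "\<not> (\<forall>p\<in>x. \<forall>q\<in>y. p < q) \<or> \<not> (\<forall>q\<in>y. \<forall>p\<in>x. q < p)" by (meson less_asym)
  then have "x \<subseteq> y \<or> y \<subseteq> x"
    using Q_le_iff[OF assms(1,2)] Q_le_iff[OF assms(2,1)] assms(3,4) by blast
  then show ?thesis using Q_le_supset_imp_eq assms by blast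
qed

lemma Q_le_total: "Q_le x y \<or> Q_le y x"
  unfolding Q_le_def by (meson linear)

lemma Q_le_trans: "\<lbrakk>Q_le x y; Q_le y z\<rbrakk> \<Longrightarrow> Q_le x z"
  unfolding Q_le_def by (meson order_trans)

lemma linear_order_Q: "linear_order_on Q {(x, y) \<in> Q \<times> Q. Q_le x y}"
  unfolding linear_order_on_def partial_order_on_def preorder_on_def
proof (intro conjI)
  show "refl_on Q {(x, y) \<in> Q \<times> Q. Q_le x y}" by (auto simp: refl_on_def Q_le_if_subset)
  show "trans {(x, y) \<in> Q \<times> Q. Q_le x y}" by (auto simp: trans_def intro: Q_le_trans)
  show "antisym {(x, y) \<in> Q \<times> Q. Q_le x y}" by (auto simp: antisym_def dest: Q_le_antisym)
  show "total_on Q {(x, y) \<in> Q \<times> Q. Q_le x y}" using Q_le_total by (auto simp: total_on_def)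
qed auto

lemma Q_le_plus_mono: "Q_le x y \<Longrightarrow> Q_le (x + z) (y + z)"
  unfolding Q_le_def by (auto elim!: set_plus_elim) (meson add_right_mono set_plus_intro)

lemma Q_le_neutrix_cases:
  assumes "x \<in> Q" "Q_le (neutrix x) x" shows "x = neutrix x \<or> (\<forall>p\<in>x. 0 < p)"
proof -
  have "0 \<in> neutrix x" using assms(1) by (simp add: convex_subgroup_zero convex_subgroup_neutrix)
  moreover have "neutrix x \<subseteq> x \<or> (\<forall>p\<in>neutrix x. \<forall>q\<in>x. p < q)"
    using assms by (simp add: Q_le_iff neutrix_in_Q)
  ultimately show ?thesis using eq_neutrix_iff_zero_mem[OF assms(1)] by blast
qed

lemma Q_le_times_mono:
  assumes "x \<in> Q" "Q_le (neutrix x) x" "neutrix x \<noteq> x" "Q_le y z"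
  shows "Q_le (x * y) (x * z)"
  unfolding Q_le_def
proof
  fix t assume "t \<in> x * y"
  then obtain p q where t_eq: "t = p * q" and p_in: "p \<in> x" and "q \<in> y"
    by (auto elim: set_times_elim)
  have "0 < p" using Q_le_neutrix_cases[OF assms(1,2)] assms(3) p_in by auto
  moreover obtain r where "r \<in> z" "q \<le> r" using assms(4) \<open>q \<in> y\<close> by (auto simp: Q_le_def)
  ultimately show "\<exists>w\<in>x * z. t \<le> w"
    using p_in by (intro bexI[of _ "p * r"] set_times_intro) (simp_all add: t_eq mult_left_mono)
qed

lemma Q_le_convex_subgroup_times_mono:
  assumes convex_A: "convex_subgroup A" and y_in: "y \<in> Q"
    and y_nonneg: "Q_le (neutrix y) y" and y_le_z: "Q_le y z"
  shows "Q_le (A * y) (A * z)"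
  unfolding Q_le_def
proof
  fix t assume "t \<in> A * y"
  then obtain p q where t_eq: "t = p * q" and p_in: "p \<in> A" and q_in: "q \<in> y"
    by (auto elim: set_times_elim)
  have "\<bar>q\<bar> \<in> y" using Q_le_neutrix_cases[OF y_in y_nonneg]
  proof
    assume "y = neutrix y"
    then have "convex_subgroup y" using convex_subgroup_neutrix[OF y_in] by simp
    then show ?thesis using q_in by (simp add: convex_subgroup_abs_iff)
  next
    assume "\<forall>p\<in>y. 0 < p"
    then have "0 < q" using q_in by blast
    then show ?thesis using q_in by simp
  qed
  then obtain r where r_in: "r \<in> z" and abs_q_le: "\<bar>q\<bar> \<le> r" using y_le_z by (auto simp: Q_le_def)
  have "t \<le> \<bar>p\<bar> * \<bar>q\<bar>" using abs_ge_self[of t] by (simp add: t_eq abs_mult)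
  also have "\<dots> \<le> \<bar>p\<bar> * r" using abs_q_le by (simp add: mult_left_mono)
  finally have "t \<le> \<bar>p\<bar> * r" .
  moreover have "\<bar>p\<bar> * r \<in> A * z"
    using p_in r_in convex_A by (simp add: convex_subgroup_abs_iff set_times_intro)
  ultimately show "\<exists>w\<in>A * z. t \<le> w" by blast
qed

lemma absorbed_imp_Q_le_neutrix:
  assumes x_in: "x \<in> Q" and y_in: "y \<in> Q" and absorbed: "y + neutrix x = neutrix x"
  shows "Q_le y (neutrix x)" and "Q_le (symmetric Q Q_add y) (neutrix x)"
proof -
  have convex_neutrix: "convex_subgroup (neutrix x)" using x_in by (rule convex_subgroup_neutrix)
  have subset: "y \<subseteq> neutrix x"
    using set_zero_plus2[OF convex_subgroup_zero[OF convex_neutrix], of y] absorbed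
    by (simp add: add.commute)
  then show "Q_le y (neutrix x)" by (rule Q_le_if_subset)
  have "(- 1) *o y \<subseteq> (- 1) *o neutrix x" using subset by (rule set_times_mono)
  then show "Q_le (symmetric Q Q_add y) (neutrix x)"
    by (simp add: Q_le_if_subset symmetric_eq_scale y_in convex_neutrix
        convex_subgroup_uminus_one_scale)
qed

lemma ordered_association_Q:
  "ordered_association (Q :: 'a::linordered_field set set) Q_add Q_mult Q_le"
proof -
  interpret association "Q :: 'a set set" Q_add Q_mult by (rule association_Q)
  show ?thesis
  proof (standard, rule linear_order_Q)
    fix x y z :: "'a set" assume in_Q: "x \<in> Q" "y \<in> Q" "z \<in> Q"
    show "Q_le (Q_add x z) (Q_add y z)" if "Q_le x y"
      using that in_Q by (simp add: Q_add_eq_plus Q_le_plus_mono)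
    show "Q_le (Q_mult x y) (Q_mult x z)" if "Q_le (e x) x" "e x \<noteq> x" "Q_le y z"
      using that in_Q by (simp add: Q_mult_eq_times Q_le_times_mono)
    show "Q_le (Q_mult (e x) y) (Q_mult (e x) z)" if "Q_le (e y) y" "Q_le y z"
      using that in_Q by (simp add: Q_mult_eq_times neutrix_in_Q convex_subgroup_neutrix
          Q_le_convex_subgroup_times_mono)
  next
    fix x y :: "'a set" assume "x \<in> Q" "y \<in> Q" "Q_add y (e x) = e x"
    then show "Q_le y (e x) \<and> Q_le (s y) (e x)"
      by (simp add: Q_add_eq_plus neutrix_in_Q absorbed_imp_Q_le_neutrix)
  qed
qed

section \<open>The solid axioms\<close>

lemma UNIV_in_Q: "UNIV \<in> Q"
  using convex_subgroup_UNIV by (rule convex_subgroup_in_Q)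

lemma Q_eq_precise_plus_neutrix:
  assumes "x \<in> Q" shows "\<exists>a\<in>Q. x = Q_add a (neutrix x) \<and> neutrix a = {0}"
proof -
  obtain a where "a \<in> x" using Q_nonempty[OF assms] by blast
  then have "x = a +o neutrix x" using assms by (simp add: coset_neutrix)
  also have "\<dots> = {a} + neutrix x" by (auto simp: elt_set_plus_def set_plus_def)
  also have "\<dots> = Q_add {a} (neutrix x)"
    using assms by (simp add: Q_add_eq_plus singleton_in_Q neutrix_in_Q)
  finally show ?thesis using singleton_in_Q neutrix_singleton by blast
qed

lemma ex_zeroless_between_convex_subgroups:
  assumes convex_A: "convex_subgroup A" and convex_B: "convex_subgroup B"
    and A_less_B: "Q_le A B" "A \<noteq> B"
  shows "\<exists>z\<in>Q. 0 \<notin> z \<and> Q_le A z \<and> Q_le z B"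
proof -
  have "\<not> B \<subseteq> A" using Q_le_supset_imp_eq convex_A convex_B A_less_B convex_subgroup_in_Q by blast
  then obtain b where b_in: "b \<in> B" and b_notin: "b \<notin> A" by blast
  have "Q_le A {\<bar>b\<bar>}"
    using convex_subgroup_abs_less[OF convex_A _ b_notin]
    by (auto simp: Q_le_def abs_less_iff less_imp_le)
  moreover have "Q_le {\<bar>b\<bar>} B"
    using b_in convex_B by (simp add: Q_le_if_subset convex_subgroup_abs_iff)
  moreover have "0 \<notin> {\<bar>b\<bar>}" using b_notin convex_subgroup_zero[OF convex_A] by auto
  ultimately show ?thesis using singleton_in_Q by blast
qed

lemma ex_proper_neutrix:
  assumes nonarchimedean: "\<exists>x::'a::linordered_field. \<forall>n::nat. of_nat n < x"
  shows "\<exists>x\<in>(Q :: 'a set set). neutrix x \<noteq> {0} \<and> neutrix x \<noteq> UNIV"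
proof -
  obtain A :: "'a set" where "convex_subgroup A" "A \<noteq> {0}" "A \<noteq> UNIV"
    using ex_proper_convex_subgroup[OF nonarchimedean] by blast
  then show ?thesis
    by (intro bexI[of _ A]) (simp_all add: neutrix_convex_subgroup convex_subgroup_in_Q)
qed

lemma Q_separation:
  assumes in_Q: "x \<in> Q" "y \<in> Q" and neutrices: "x = neutrix x" "y = neutrix y"
    and x_less_y: "Q_le x y \<and> x \<noteq> y"
  shows "\<exists>z\<in>Q. z \<noteq> neutrix z \<and> (Q_le x z \<and> x \<noteq> z) \<and> (Q_le z y \<and> z \<noteq> y)"
proof -
  have "0 \<in> x" "0 \<in> y" using eq_neutrix_iff_zero_mem in_Q neutrices by blast+
  then have "convex_subgroup x" "convex_subgroup y"
    using in_Q by (simp_all add: convex_subgroup_iff_zero_mem)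
  then obtain z where "z \<in> Q" "0 \<notin> z" "Q_le x z" "Q_le z y"
    using ex_zeroless_between_convex_subgroups x_less_y by blast
  moreover have "z \<noteq> neutrix z" using calculation eq_neutrix_iff_zero_mem by blast
  ultimately show ?thesis using \<open>0 \<in> x\<close> \<open>0 \<in> y\<close> by blast
qed

lemma solid_Q:
  assumes nonarchimedean: "\<exists>x::'a::linordered_field. \<forall>n::nat. of_nat n < x"
  shows "solid (Q :: 'a set set) Q_add Q_mult Q_le"
proof (rule solid.intro[OF ordered_association_Q], standard)
  have zero: "Q_add {0} x = x" and UNIV: "Q_add (neutrix x) UNIV = UNIV"
    if "x \<in> Q" for x :: "'a set"
    using that by (simp_all add: Q_add_eq_plus singleton_in_Q UNIV_in_Q neutrix_in_Q
        convex_subgroup_absorb convex_subgroup_neutrix convex_subgroup_UNIV)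
  show "\<exists>m\<in>Q. \<exists>M\<in>Q. (\<forall>x\<in>Q. Q_add m x = x) \<and> (\<forall>x\<in>Q. Q_add (neutrix x) M = M)
      \<and> (\<forall>x\<in>Q. \<exists>a\<in>Q. x = Q_add a (neutrix x) \<and> neutrix a = m)
      \<and> (\<exists>x\<in>(Q :: 'a set set). neutrix x \<noteq> m \<and> neutrix x \<noteq> M)"
    by (rule bexI[OF bexI[OF _ UNIV_in_Q] singleton_in_Q[of 0]])
      (intro conjI ballI zero UNIV Q_eq_precise_plus_neutrix ex_proper_neutrix nonarchimedean)
  have "{1} * x = x" for x :: "'a set" by (simp flip: set_one)
  then show "\<exists>u0\<in>Q. \<forall>x\<in>(Q :: 'a set set). Q_mult u0 x = x"
    by (intro bexI[of _ "{1}"]) (simp_all add: Q_mult_eq_times singleton_in_Q)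
qed (rule Q_separation; assumption)

theorem theorem5p3:
  assumes nonarchimedean: "\<exists>x::'a::linordered_field. \<forall>n::nat. of_nat n < x"
  shows "solid (Q :: 'a set set) Q_add Q_mult Q_le \<and>
    (\<forall>(a::'a) A. convex_subgroup A \<longrightarrow>
        neutral Q Q_add (a +o A) = A
      \<and> symmetric Q Q_add (a +o A) = (- a) +o A
      \<and> (\<not> convex_subgroup (a +o A) \<longrightarrow>
            neutral (zeroless Q Q_add) Q_mult (a +o A) = 1 +o ((\<lambda>x. x / a) ` A)
          \<and> symmetric (zeroless Q Q_add) Q_mult (a +o A) = (1 / a) +o ((\<lambda>x. x / a\<^sup>2) ` A)))"
proof (intro conjI allI impI)
  show "solid (Q :: 'a set set) Q_add Q_mult Q_le" using nonarchimedean by (rule solid_Q)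
next
  fix a :: 'a and A :: "'a set" assume convex_A: "convex_subgroup A"
  show "neutral Q Q_add (a +o A) = A" using convex_A by (rule neutrix_coset)
  show "symmetric Q Q_add (a +o A) = (- a) +o A" using convex_A by (rule symmetric_coset)
  assume "\<not> convex_subgroup (a +o A)"
  then have a_notin: "a \<notin> A" using convex_A coset_eq_self by metis
  show "neutral (zeroless Q Q_add) Q_mult (a +o A) = 1 +o ((\<lambda>x. x / a) ` A)"
    using convex_A a_notin by (rule unity_coset)
  show "symmetric (zeroless Q Q_add) Q_mult (a +o A) = (1 / a) +o ((\<lambda>x. x / a\<^sup>2) ` A)"
    using convex_A a_notin by (rule reciprocal_coset)
qed

end
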